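(* Let $A$ be an MV-algebra. Every quasimaximal ideal of $A$ is a quasihyperradical ideal. (That is, quasisimple MV-algebras are quasihyperarchimedean.)
   Context: In an MV-algebra $(A,\oplus,\neg,0)$ put $1=\neg 0$, $x\odot y=\neg(\neg x\oplus\neg y)$, $x\ominus y=x\odot\neg y$, $x\le y$ iff $x\ominus y=0$, and $na=a\oplus\cdots\oplus a$ ($n$ times, $0a=0$). An ideal is a subset containing $0$, closed under $\oplus$ and downward closed. For an ideal $I\subset A$: $\sqrt{I}=\{a\in A\mid na\ominus\neg a\in I\text{ for each integer }n\ge 0\}$. $I$ is quasimaximal if for all $x\in A$: $x\notin I$ if and only if there exists an integer $n\ge 1$ such that $\neg(nx)\in\sqrt{I}$. $I$ is quasihyperradical if for any $x\in A$ there is an integer $n\ge 1$ such that $(n+1)x\ominus nx\in\sqrt{I}$. $A$ is quasisimple (resp. quasihyperarchimedean) if its ideal $\{0\}$ is quasimaximal (resp. quasihyperradical). *)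

theory Defs
  imports "HOL-Algebra.Congruence"
begin

record 'a mv_struct = "'a partial_object" +
  mv_add :: "'a \<Rightarrow> 'a \<Rightarrow> 'a"  (infixl \<open>\<oplus>\<index>\<close> 65)
  mv_neg :: "'a \<Rightarrow> 'a"  (\<open>\<sim>\<index> _\<close> [81] 80)
  mv_zero :: "'a"  (\<open>\<zero>\<index>\<close>)

text \<open>Chang's axioms in the short form due to Mangani.\<close>

locale mv_algebra =
  fixes A (structure)
  assumes add_closed: "\<lbrakk>x \<in> carrier A; y \<in> carrier A\<rbrakk> \<Longrightarrow> x \<oplus> y \<in> carrier A"
    and neg_closed: "x \<in> carrier A \<Longrightarrow> \<sim> x \<in> carrier A"
    and zero_closed: "\<zero> \<in> carrier A"
    and add_assoc: "\<lbrakk>x \<in> carrier A; y \<in> carrier A; z \<in> carrier A\<rbrakk>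
                      \<Longrightarrow> x \<oplus> (y \<oplus> z) = (x \<oplus> y) \<oplus> z"
    and add_comm: "\<lbrakk>x \<in> carrier A; y \<in> carrier A\<rbrakk> \<Longrightarrow> x \<oplus> y = y \<oplus> x"
    and add_zero: "x \<in> carrier A \<Longrightarrow> x \<oplus> \<zero> = x"
    and neg_neg: "x \<in> carrier A \<Longrightarrow> \<sim> (\<sim> x) = x"
    and add_neg_zero: "x \<in> carrier A \<Longrightarrow> x \<oplus> \<sim> \<zero> = \<sim> \<zero>"
    and lukasiewicz: "\<lbrakk>x \<in> carrier A; y \<in> carrier A\<rbrakk>
                      \<Longrightarrow> \<sim> (\<sim> x \<oplus> y) \<oplus> y = \<sim> (\<sim> y \<oplus> x) \<oplus> x"

definition mv_odot :: "('a, 'b) mv_struct_scheme \<Rightarrow> 'a \<Rightarrow> 'a \<Rightarrow> 'a"  (infixl \<open>\<odot>\<index>\<close> 70)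
  where "x \<odot>\<^bsub>A\<^esub> y = \<sim>\<^bsub>A\<^esub> (\<sim>\<^bsub>A\<^esub> x \<oplus>\<^bsub>A\<^esub> \<sim>\<^bsub>A\<^esub> y)"

definition mv_diff :: "('a, 'b) mv_struct_scheme \<Rightarrow> 'a \<Rightarrow> 'a \<Rightarrow> 'a"  (infixl \<open>\<ominus>\<index>\<close> 65)
  where "x \<ominus>\<^bsub>A\<^esub> y = x \<odot>\<^bsub>A\<^esub> \<sim>\<^bsub>A\<^esub> y"

definition mv_le :: "('a, 'b) mv_struct_scheme \<Rightarrow> 'a \<Rightarrow> 'a \<Rightarrow> bool"  (infix \<open>\<preceq>\<index>\<close> 50)
  where "x \<preceq>\<^bsub>A\<^esub> y \<longleftrightarrow> x \<ominus>\<^bsub>A\<^esub> y = \<zero>\<^bsub>A\<^esub>"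

primrec mv_mult :: "('a, 'b) mv_struct_scheme \<Rightarrow> nat \<Rightarrow> 'a \<Rightarrow> 'a"
  where
    "mv_mult A 0 a = \<zero>\<^bsub>A\<^esub>"
  | "mv_mult A (Suc n) a = mv_mult A n a \<oplus>\<^bsub>A\<^esub> a"

definition mv_ideal :: "('a, 'b) mv_struct_scheme \<Rightarrow> 'a set \<Rightarrow> bool"
  where "mv_ideal A I \<longleftrightarrow>
    I \<subseteq> carrier A \<and> \<zero>\<^bsub>A\<^esub> \<in> I \<and>
    (\<forall>x\<in>I. \<forall>y\<in>I. x \<oplus>\<^bsub>A\<^esub> y \<in> I) \<and>
    (\<forall>x\<in>carrier A. \<forall>y\<in>I. x \<preceq>\<^bsub>A\<^esub> y \<longrightarrow> x \<in> I)"

definition mv_sqrt :: "('a, 'b) mv_struct_scheme \<Rightarrow> 'a set \<Rightarrow> 'a set"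
  where "mv_sqrt A I =
    {a \<in> carrier A. \<forall>n::nat. mv_mult A n a \<ominus>\<^bsub>A\<^esub> \<sim>\<^bsub>A\<^esub> a \<in> I}"

definition quasimaximal_ideal :: "('a, 'b) mv_struct_scheme \<Rightarrow> 'a set \<Rightarrow> bool"
  where "quasimaximal_ideal A I \<longleftrightarrow>
    mv_ideal A I \<and>
    (\<forall>x\<in>carrier A. x \<notin> I \<longleftrightarrow> (\<exists>n::nat. n \<ge> 1 \<and> \<sim>\<^bsub>A\<^esub> (mv_mult A n x) \<in> mv_sqrt A I))"

definition quasihyperradical_ideal :: "('a, 'b) mv_struct_scheme \<Rightarrow> 'a set \<Rightarrow> bool"
  where "quasihyperradical_ideal A I \<longleftrightarrow>
    mv_ideal A I \<and>
    (\<forall>x\<in>carrier A. \<exists>n::nat. n \<ge> 1 \<and>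
       mv_mult A (n + 1) x \<ominus>\<^bsub>A\<^esub> mv_mult A n x \<in> mv_sqrt A I)"

definition quasisimple :: "('a, 'b) mv_struct_scheme \<Rightarrow> bool"
  where "quasisimple A \<longleftrightarrow> quasimaximal_ideal A {\<zero>\<^bsub>A\<^esub>}"

definition quasihyperarchimedean :: "('a, 'b) mv_struct_scheme \<Rightarrow> bool"
  where "quasihyperarchimedean A \<longleftrightarrow> quasihyperradical_ideal A {\<zero>\<^bsub>A\<^esub>}"

end

theory Submission
  imports Defs
begin

text \<open>
  Since $na \ominus \neg a = na \odot a$ is monotone in $a$ and lies below $a$, the set $\sqrt I$ is
  downward closed and contains $I$. If $x \notin I$, quasimaximality gives $n$ with
  $\neg(nx) \in \sqrt I$, and $(n+1)x \ominus nx \le \neg(nx)$. If $x \in I$, then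
  $2x \ominus x \le 2x \in I \subseteq \sqrt I$.
\<close>

context mv_algebra
begin

lemma zero_add: "x \<in> carrier A \<Longrightarrow> \<zero> \<oplus> x = x"
  by (metis add_comm add_zero zero_closed)

text \<open>Put \<open>y = \<sim> \<zero>\<close> in the Lukasiewicz axiom: the left side is
  absorbed to \<open>\<sim> \<zero>\<close>, and the right side simplifies to
  \<open>\<sim> x \<oplus> x\<close>.\<close>

lemma add_neg_self: "x \<in> carrier A \<Longrightarrow> \<sim> x \<oplus> x = \<sim> \<zero>"
  using lukasiewicz[of x "\<sim> \<zero>"]
  by (simp add: neg_closed zero_closed add_neg_zero neg_neg zero_add)

lemma odot_closed: "\<lbrakk>x \<in> carrier A; y \<in> carrier A\<rbrakk> \<Longrightarrow> x \<odot> y \<in> carrier A"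
  by (simp add: mv_odot_def add_closed neg_closed)

lemma diff_closed: "\<lbrakk>x \<in> carrier A; y \<in> carrier A\<rbrakk> \<Longrightarrow> x \<ominus> y \<in> carrier A"
  by (simp add: mv_diff_def odot_closed neg_closed)

lemma mult_closed: "x \<in> carrier A \<Longrightarrow> mv_mult A n x \<in> carrier A"
  by (induction n) (simp_all add: zero_closed add_closed)

text \<open>Unfolded, \<open>x \<ominus> y\<close> is
  \<open>\<sim> (\<sim> x \<oplus> \<sim> (\<sim> y))\<close>; negate the equation with
  \<open>\<zero>\<close>. Order questions thereby become equations in sum and negation.\<close>

lemma le_iff_neg_add:
  assumes "x \<in> carrier A" "y \<in> carrier A"
  shows "x \<preceq> y \<longleftrightarrow> \<sim> x \<oplus> y = \<sim> \<zero>"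
  using assms unfolding mv_le_def mv_diff_def mv_odot_def
  by (metis add_closed neg_closed neg_neg zero_closed)

lemma le_add:
  assumes "x \<in> carrier A" "z \<in> carrier A"
  shows "x \<preceq> x \<oplus> z"
proof -
  \<comment> \<open>After reassociation \<open>\<sim> x\<close> and \<open>x\<close> add up to the
    top element, which absorbs \<open>z\<close>.\<close>
  have "\<sim> x \<oplus> (x \<oplus> z) = \<sim> \<zero> \<oplus> z"
    using assms by (simp add: add_assoc neg_closed add_neg_self)
  also have "\<dots> = \<sim> \<zero>"
    using assms by (metis add_comm add_neg_zero neg_closed zero_closed)
  finally show ?thesis
    using assms by (simp add: le_iff_neg_add add_closed)
qed

text \<open>This form reduces transitivity and monotonicity of sums to associativity and
  commutativity.\<close>

lemma le_iff_add:
  assumes "x \<in> carrier A" "y \<in> carrier A"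
  shows "x \<preceq> y \<longleftrightarrow> (\<exists>z\<in>carrier A. y = x \<oplus> z)"
proof
  assume "x \<preceq> y"
  \<comment> \<open>The added summand is \<open>\<zero>\<close>, because
    \<open>\<sim> x \<oplus> y\<close> is the top element.\<close>
  then have "y = \<sim> (\<sim> x \<oplus> y) \<oplus> y"
    using assms by (simp add: le_iff_neg_add neg_neg zero_closed zero_add)
  \<comment> \<open>The Lukasiewicz axiom exchanges \<open>x\<close> and \<open>y\<close>; the
    summand that appears is \<open>y \<ominus> x\<close>, the required witness.\<close>
  also have "\<dots> = x \<oplus> \<sim> (\<sim> y \<oplus> x)"
    using assms by (metis lukasiewicz add_comm add_closed neg_closed)
  finally show "\<exists>z\<in>carrier A. y = x \<oplus> z"
    using assms by (blast intro: add_closed neg_closed)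
qed (use assms le_add in blast)

lemma le_trans:
  assumes "x \<preceq> y" "y \<preceq> z" "x \<in> carrier A" "y \<in> carrier A" "z \<in> carrier A"
  shows "x \<preceq> z"
  using assms by (metis le_iff_add add_assoc add_closed)

text \<open>By \<open>le_iff_neg_add\<close> both inequalities state the same equation, up to
  commutativity and double negation.\<close>

lemma neg_antimono:
  assumes "x \<preceq> y" "x \<in> carrier A" "y \<in> carrier A"
  shows "\<sim> y \<preceq> \<sim> x"
  using assms by (metis le_iff_neg_add add_comm neg_closed neg_neg)

lemma add_right_mono:
  assumes "x \<preceq> y" "x \<in> carrier A" "y \<in> carrier A" "z \<in> carrier A"
  shows "x \<oplus> z \<preceq> y \<oplus> z"
proof -
  obtain w where w: "w \<in> carrier A" "y = x \<oplus> w"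
    using assms le_iff_add by blast
  \<comment> \<open>The witness \<open>w\<close> for \<open>x \<preceq> y\<close> also serves after
    adding \<open>z\<close>.\<close>
  have "y \<oplus> z = (x \<oplus> z) \<oplus> w"
    using assms w by (metis add_assoc add_comm)
  then show ?thesis
    using assms w by (simp add: le_add add_closed)
qed

lemma add_mono:
  assumes "x \<preceq> y" "u \<preceq> v"
    and "x \<in> carrier A" "y \<in> carrier A" "u \<in> carrier A" "v \<in> carrier A"
  shows "x \<oplus> u \<preceq> y \<oplus> v"
proof (rule le_trans)
  show "x \<oplus> u \<preceq> y \<oplus> u"
    using assms by (simp add: add_right_mono)
  show "y \<oplus> u \<preceq> y \<oplus> v"
    using assms add_right_mono[of u v y] by (simp add: add_comm)
qed (use assms in \<open>simp_all add: add_closed\<close>)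

text \<open>The order is reversed once by the inner negations and once more by the outer
  one.\<close>

lemma odot_mono:
  assumes "x \<preceq> y" "u \<preceq> v"
    and "x \<in> carrier A" "y \<in> carrier A" "u \<in> carrier A" "v \<in> carrier A"
  shows "x \<odot> u \<preceq> y \<odot> v"
  unfolding mv_odot_def using assms
  by (intro neg_antimono add_mono) (simp_all add: neg_closed add_closed)

lemma mult_mono:
  assumes "x \<preceq> y" "x \<in> carrier A" "y \<in> carrier A"
  shows "mv_mult A n x \<preceq> mv_mult A n y"
proof (induction n)
  case 0
  show ?case
    by (simp add: le_iff_neg_add zero_closed add_neg_self)
next
  case (Suc n)
  then show ?case
    using assms by (simp add: add_mono mult_closed)
qed

lemma odot_le_left:
  assumes "x \<in> carrier A" "y \<in> carrier A"
  shows "x \<odot> y \<preceq> x"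
proof -
  \<comment> \<open>Negate \<open>\<sim> x \<preceq> \<sim> x \<oplus> \<sim> y\<close>.\<close>
  have "\<sim> (\<sim> x \<oplus> \<sim> y) \<preceq> \<sim> (\<sim> x)"
    using assms by (intro neg_antimono le_add) (simp_all add: neg_closed add_closed)
  then show ?thesis
    using assms by (simp add: mv_odot_def neg_neg)
qed

lemma odot_comm:
  assumes "x \<in> carrier A" "y \<in> carrier A"
  shows "x \<odot> y = y \<odot> x"
  using assms by (simp add: mv_odot_def add_comm neg_closed)

lemma odot_le_right:
  assumes "x \<in> carrier A" "y \<in> carrier A"
  shows "x \<odot> y \<preceq> y"
  using assms odot_le_left[of y x] by (simp add: odot_comm)

lemma mem_sqrt_iff:
  assumes "a \<in> carrier A"
  shows "a \<in> mv_sqrt A I \<longleftrightarrow> (\<forall>n. mv_mult A n a \<odot> a \<in> I)"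
  using assms by (simp add: mv_sqrt_def mv_diff_def neg_neg)

lemma ideal_downward:
  assumes "mv_ideal A I" "x \<preceq> y" "x \<in> carrier A" "y \<in> I"
  shows "x \<in> I"
  using assms unfolding mv_ideal_def by blast

lemma sqrt_downward:
  assumes "mv_ideal A I" "a \<preceq> b" "a \<in> carrier A" "b \<in> mv_sqrt A I"
  shows "a \<in> mv_sqrt A I"
proof -
  have b: "b \<in> carrier A"
    using assms(4) by (simp add: mv_sqrt_def)
  have "mv_mult A n a \<odot> a \<in> I" for n
  proof (rule ideal_downward[OF assms(1)])
    show "mv_mult A n a \<odot> a \<preceq> mv_mult A n b \<odot> b"
      using assms b by (simp add: odot_mono mult_mono mult_closed)
    show "mv_mult A n b \<odot> b \<in> I"
      using assms(4) b by (simp add: mem_sqrt_iff)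
  qed (use assms in \<open>simp add: odot_closed mult_closed\<close>)
  then show ?thesis
    using assms(3) by (simp add: mem_sqrt_iff)
qed

lemma ideal_subset_sqrt:
  assumes "mv_ideal A I"
  shows "I \<subseteq> mv_sqrt A I"
proof
  fix a
  assume a: "a \<in> I"
  then have "a \<in> carrier A"
    using assms by (auto simp: mv_ideal_def)
  then show "a \<in> mv_sqrt A I"
    using ideal_downward[OF assms _ _ a]
    by (simp add: mem_sqrt_iff odot_le_right odot_closed mult_closed)
qed

lemma quasimaximal_imp_quasihyperradical:
  assumes "quasimaximal_ideal A I"
  shows "quasihyperradical_ideal A I"
  unfolding quasihyperradical_ideal_def
proof (intro conjI ballI)
  show I: "mv_ideal A I"
    using assms by (simp add: quasimaximal_ideal_def)
  fix x
  assume x: "x \<in> carrier A"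
  have diff: "mv_mult A (n + 1) x \<ominus> mv_mult A n x \<in> carrier A" for n
    by (rule diff_closed[OF mult_closed[OF x] mult_closed[OF x]])
  show "\<exists>n\<ge>1. mv_mult A (n + 1) x \<ominus> mv_mult A n x \<in> mv_sqrt A I"
  proof (cases "x \<in> I")
    case True
    have "mv_mult A n x \<in> I" for n
      using I True by (induction n) (simp_all add: mv_ideal_def)
    \<comment> \<open>The witness is \<open>n = 1\<close>, the smallest value allowed.\<close>
    moreover have "mv_mult A (1 + 1) x \<ominus> mv_mult A 1 x \<preceq> mv_mult A (1 + 1) x"
      unfolding mv_diff_def using x by (intro odot_le_left neg_closed mult_closed)
    ultimately have "mv_mult A (1 + 1) x \<ominus> mv_mult A 1 x \<in> mv_sqrt A I"
      using ideal_downward[OF I _ diff] ideal_subset_sqrt[OF I] by blast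
    then show ?thesis
      by blast
  next
    case False
    then obtain n where n: "n \<ge> 1" "\<sim> (mv_mult A n x) \<in> mv_sqrt A I"
      using assms x by (auto simp: quasimaximal_ideal_def)
    \<comment> \<open>The difference is a product with right factor
      \<open>\<sim> (mv_mult A n x)\<close>, so the \<open>n\<close> from quasimaximality is itself
      the witness.\<close>
    have "mv_mult A (n + 1) x \<ominus> mv_mult A n x \<preceq> \<sim> (mv_mult A n x)"
      unfolding mv_diff_def using x by (intro odot_le_right neg_closed mult_closed)
    then show ?thesis
      using sqrt_downward[OF I _ diff] n by blast
  qed
qed

end

theorem proposition4p8:
  fixes A :: "('a, 'b) mv_struct_scheme"
  assumes "mv_algebra A"
  shows "(\<forall>I. quasimaximal_ideal A I \<longrightarrow> quasihyperradical_ideal A I) \<and>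
         (quasisimple A \<longrightarrow> quasihyperarchimedean A)"
  \<comment> \<open>The second conjunct is the case \<open>I = {\<zero>}\<close> of the
    first.\<close>
  using mv_algebra.quasimaximal_imp_quasihyperradical[OF assms]
  by (simp add: quasisimple_def quasihyperarchimedean_def)

end
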